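(* Let $I\subseteq\mathbb{R}$ be an interval with interior $I^{\circ}$, let $f:I\to\mathbb{R}$ be twice differentiable on $I^{\circ}$, and let $a,b\in I^{\circ}$ with $a<b$ and $f''\in L[a,b]$. Let $q\ge1$, let $s\in(0,1]$ be fixed, and suppose that $|f''|^{q}$ is $s$-convex in the second sense on $I$. Then for every $\alpha>0$, $$\left|\frac{f(a)+f(b)}{2}-\frac{\Gamma(\alpha+1)}{2(b-a)^{\alpha}}\left[J_{a^{+}}^{\alpha}f(b)+J_{b^{-}}^{\alpha}f(a)\right]\right|\le \frac{\alpha(b-a)^{2}}{4(\alpha+1)(\alpha+2)}\Biggl[\left(|f''(a)|^{q}\frac{2\alpha+4}{(s+2)(\alpha+s+2)}+|f''(b)|^{q}\bigl[\beta(2,s+1)-\beta(\alpha+2,s+1)\bigr]\frac{2\alpha+4}{\alpha}\right)^{\frac1q}$$ $$\qquad+\left(|f''(a)|^{q}\bigl[\beta(2,s+1)-\beta(\alpha+2,s+1)\bigr]\frac{2\alpha+4}{\alpha}+|f''(b)|^{q}\frac{2\alpha+4}{(s+2)(\alpha+s+2)}\right)^{\frac1q}\Biggr].$$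
   Context: Here $L[a,b]$ is the space of Lebesgue integrable functions on $[a,b]$. The Riemann-Liouville fractional integrals of order $\alpha>0$ of $f$ are $J_{a^{+}}^{\alpha}f(x)=\frac{1}{\Gamma(\alpha)}\int_{a}^{x}(x-t)^{\alpha-1}f(t)\,dt$ for $x>a$ and $J_{b^{-}}^{\alpha}f(x)=\frac{1}{\Gamma(\alpha)}\int_{x}^{b}(t-x)^{\alpha-1}f(t)\,dt$ for $x<b$, where $\Gamma(\alpha)=\int_{0}^{\infty}e^{-u}u^{\alpha-1}\,du$ is the Gamma function. $\beta(x,y)=\int_0^1 t^{x-1}(1-t)^{y-1}\,dt$ is the Euler Beta function. A real-valued function $g$ is $s$-convex in the second sense, for a fixed $s\in(0,1]$, if $g(\lambda x+(1-\lambda)y)\le \lambda^{s}g(x)+(1-\lambda)^{s}g(y)$ for all $x,y$ in its domain and all $\lambda\in[0,1]$. Since $f''$ is only given on $I^{\circ}$, "$|f''|^{q}$ is $s$-convex on $I$" means that this inequality holds for $g=|f''|^{q}$ and all $x,y\in I^{\circ}$, $\lambda\in[0,1]$. *)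

theory Defs imports "HOL-Analysis.Analysis" begin

(* The kernels use powr with 0 powr y = 0; for alpha \<le> 1 this changes the
   integrand only at the single endpoint t = x, a null set. *)

definition RL_integral_left :: "real \<Rightarrow> real \<Rightarrow> (real \<Rightarrow> real) \<Rightarrow> real \<Rightarrow> real" where
  "RL_integral_left \<alpha> a f x =
     1 / Gamma \<alpha> * (LINT t:{a..x}|lebesgue. (x - t) powr (\<alpha> - 1) * f t)"

definition RL_integral_right :: "real \<Rightarrow> real \<Rightarrow> (real \<Rightarrow> real) \<Rightarrow> real \<Rightarrow> real" where
  "RL_integral_right \<alpha> b f x =
     1 / Gamma \<alpha> * (LINT t:{x..b}|lebesgue. (t - x) powr (\<alpha> - 1) * f t)"

(* s-convexity in the second sense; meant for 0 < s \<le> 1 and convex S. *)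
definition s_convex_on :: "real \<Rightarrow> real set \<Rightarrow> (real \<Rightarrow> real) \<Rightarrow> bool" where
  "s_convex_on s S g \<longleftrightarrow>
     (\<forall>x\<in>S. \<forall>y\<in>S. \<forall>l\<in>{0..1}.
        g (l * x + (1 - l) * y) \<le> l powr s * g x + (1 - l) powr s * g y)"

end

theory Submission imports Defs begin

text \<open>
  With the kernel \<open>P t = (b - a) powr (\<alpha> + 1) - (b - t) powr (\<alpha> + 1) - (t - a) powr (\<alpha> + 1)\<close>, which
  vanishes at \<open>a\<close> and \<open>b\<close> and whose second derivative is a multiple of the sum of the two
  Riemann-Liouville kernels, integration by parts expresses the error of the fractional trapezoid rule
  as the integral of \<open>P * f''\<close>, divided by \<open>2 * (\<alpha> + 1) * (b - a) powr \<alpha>\<close>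
  (\<open>fractional_trapezoid_identity\<close>). On the unit interval the kernel splits into the weight
  \<open>w u = u * (1 - u powr \<alpha>)\<close> and its reflection (\<open>integral_trapezoid_kernel_split\<close>), so that the error is
  \<open>(b - a)\<^sup>2 / (2 * (\<alpha> + 1))\<close> times the sum of the integrals over \<open>{0..1}\<close> of
  \<open>w u * f'' (a + (b - a) * u)\<close> and \<open>w u * f'' (b - (b - a) * u)\<close>.

  Each of the two integrals is estimated by the power mean inequality for the nonnegative weight \<open>w\<close>
  (\<open>weighted_power_mean\<close>). The convexity hypothesis bounds \<open>\<bar>f''\<bar> powr q\<close> along the segment by
  the sum of \<open>u powr s\<close> and \<open>(1 - u) powr s\<close> times the values at the two end points, and the integrals
  of these powers against \<open>w\<close> are an elementary fraction and a difference of Beta values. Divided by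
  the integral of \<open>w\<close>, they are the coefficients under the two roots (\<open>weighted_integral_bound\<close>).
\<close>

section \<open>The weighted power mean inequality\<close>

text \<open>Written as \<open>g = (K powr (1 - q) * g powr q) powr (1 / q) * K powr (1 - 1 / q)\<close>, the left-hand side
is a weighted geometric mean and the right-hand side the arithmetic mean with the same weights.
Equivalently, the concave function \<open>y \<mapsto> y powr (1 / q)\<close> lies below its tangent at
\<open>y = K powr q\<close>.\<close>

lemma powr_tangent_bound:
  fixes g K q :: real
  assumes "q \<ge> 1" "K > 0" "g \<ge> 0"
  shows "g \<le> 1 / q * K powr (1 - q) * g powr q + (1 - 1 / q) * K"
proof (cases "g = 0")
  case True
  then show ?thesis using assms by (simp add: field_simps)
next
  case False
  with assms have "g > 0" by simp
  have e: "(1 - q) * (1 / q) + (1 - 1 / q) = 0"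
    using assms by (simp add: field_simps)
  have "(K powr (1 - q) * g powr q) powr (1 / q) * K powr (1 - 1 / q)
        = g * (K powr ((1 - q) * (1 / q)) * K powr (1 - 1 / q))"
    using assms \<open>g > 0\<close> by (simp add: powr_mult powr_powr)
  also have "\<dots> = g"
    using assms e unfolding powr_add[symmetric] by simp
  finally show ?thesis
    using Youngs_inequality_0[of "1 / q" "1 - 1 / q" "K powr (1 - q) * g powr q" K] assms \<open>g > 0\<close>
    by (simp add: mult.assoc)
qed

text \<open>The tangent bound turns \<open>\<bar>g\<bar>\<close> into an affine function of \<open>\<phi>\<close>, so only the integrals \<open>W\<close> and \<open>V\<close> of
the explicit functions \<open>w\<close> and \<open>w * \<phi>\<close> enter. Optimising the parameter \<open>K\<close>
then gives the power mean: the best \<open>K\<close> is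
\<open>(V / W) powr (1 / q)\<close> if \<open>V\<close> is positive, and \<open>K \<rightarrow> 0\<close> if \<open>V\<close> vanishes.\<close>

lemma weighted_power_mean:
  fixes w g \<phi> :: "'a::euclidean_space \<Rightarrow> real"
  assumes W: "(w has_integral W) S" "W > 0"
    and V: "((\<lambda>x. w x * \<phi> x) has_integral V) S"
    and wg: "(\<lambda>x. w x * g x) integrable_on S"
    and w0: "\<And>x. x \<in> S \<Longrightarrow> 0 \<le> w x"
    and g\<phi>: "\<And>x. x \<in> S \<Longrightarrow> \<bar>g x\<bar> powr q \<le> \<phi> x"
    and q: "q \<ge> 1"
  shows "\<bar>integral S (\<lambda>x. w x * g x)\<bar> \<le> W * (V / W) powr (1 / q)"
proof -
  let ?I = "\<bar>integral S (\<lambda>x. w x * g x)\<bar>"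
  have "0 \<le> V"
  proof (rule has_integral_nonneg[OF V])
    show "0 \<le> w x * \<phi> x" if "x \<in> S" for x
      using w0[OF that] g\<phi>[OF that] powr_ge_zero[of "\<bar>g x\<bar>" q]
      by (intro mult_nonneg_nonneg) linarith+
  qed
  have bound: "?I \<le> 1 / q * K powr (1 - q) * V + (1 - 1 / q) * K * W" if "K > 0" for K
  proof -
    have dom: "((\<lambda>x. 1 / q * K powr (1 - q) * (w x * \<phi> x) + (1 - 1 / q) * K * w x)
            has_integral 1 / q * K powr (1 - q) * V + (1 - 1 / q) * K * W) S"
      by (intro has_integral_add has_integral_mult_right V W)
    have "norm (w x * g x) \<le> 1 / q * K powr (1 - q) * (w x * \<phi> x) + (1 - 1 / q) * K * w x"
      if x: "x \<in> S" for x
    proof -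
      have "\<bar>g x\<bar> \<le> 1 / q * K powr (1 - q) * \<bar>g x\<bar> powr q + (1 - 1 / q) * K"
        using powr_tangent_bound q \<open>K > 0\<close> by simp
      also have "\<dots> \<le> 1 / q * K powr (1 - q) * \<phi> x + (1 - 1 / q) * K"
        using g\<phi>[OF x] q by (intro add_right_mono mult_left_mono) auto
      finally have "w x * \<bar>g x\<bar> \<le> w x * (1 / q * K powr (1 - q) * \<phi> x + (1 - 1 / q) * K)"
        using w0[OF x] by (rule mult_left_mono)
      then show ?thesis using w0[OF x] by (simp add: abs_mult algebra_simps)
    qed
    from integral_norm_bound_integral[OF wg has_integral_integrable[OF dom] this]
    show ?thesis using integral_unique[OF dom] by simp
  qed
  show ?thesis
  proof (cases "V = 0")
    case False
    with \<open>0 \<le> V\<close> have "V > 0" by simp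
    define K where "K = (V / W) powr (1 / q)"
    have "K > 0" unfolding K_def using \<open>V > 0\<close> W(2) by simp
    have "K powr q = V / W"
      unfolding K_def using \<open>V > 0\<close> W(2) q by (simp add: powr_powr)
    then have "K powr (1 - q) * V = K * W"
      using \<open>K > 0\<close> W(2) \<open>V \<noteq> 0\<close> by (simp add: powr_diff)
    with bound[OF \<open>K > 0\<close>] have "?I \<le> K * W"
      by (simp add: algebra_simps)
    then show ?thesis by (simp add: K_def mult.commute)
  next
    case True
    \<comment> \<open>With \<open>K = e / W\<close> the remaining term \<open>(1 - 1 / q) * K * W\<close> is at most \<open>e\<close>.\<close>
    have "?I \<le> 0 + e" if "e > 0" for e
    proof -
      have "(1 - 1 / q) * e \<le> 1 * e"
        using q that by (intro mult_right_mono) auto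
      moreover have "?I \<le> (1 - 1 / q) * e"
        using bound[of "e / W"] True W(2) that by simp
      ultimately show ?thesis by linarith
    qed
    then have "?I \<le> 0" by (rule field_le_epsilon)
    with True show ?thesis by simp
  qed
qed

section \<open>Moments of the weight\<close>

lemma has_integral_powr_shifted:
  fixes a b c :: real
  assumes "a < b" "c > -1"
  shows "((\<lambda>t. (t - a) powr c) has_integral (b - a) powr (c + 1) / (c + 1)) {a..b}"
proof -
  have "((\<lambda>t. (t - a) powr c) has_integral
          (b - a) powr (c + 1) / (c + 1) - (a - a) powr (c + 1) / (c + 1)) {a..b}"
  proof (rule fundamental_theorem_of_calculus_interior)
    show "continuous_on {a..b} (\<lambda>t. (t - a) powr (c + 1) / (c + 1))"
      using assms by (auto intro!: continuous_intros continuous_on_powr')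
    fix t assume t: "t \<in> {a<..<b}"
    show "((\<lambda>t. (t - a) powr (c + 1) / (c + 1)) has_vector_derivative (t - a) powr c) (at t)"
      unfolding has_real_derivative_iff_has_vector_derivative[symmetric]
      using assms t by (auto intro!: derivative_eq_intros)
  qed (use assms in auto)
  then show ?thesis by simp
qed

lemma has_integral_powr_unit:
  fixes c :: real
  assumes "c > 0"
  shows "((\<lambda>t. t powr c) has_integral 1 / (c + 1)) {0..1}"
  using has_integral_powr_shifted[of 0 1 c] assms by simp

lemma has_integral_weight:
  fixes \<alpha> :: real
  assumes "\<alpha> > 0"
  shows "((\<lambda>u. u * (1 - u powr \<alpha>)) has_integral \<alpha> / (2 * (\<alpha> + 2))) {0..1}"
proof -
  have "((\<lambda>u. u powr 1 - u powr (\<alpha> + 1)) has_integral 1 / (1 + 1) - 1 / (\<alpha> + 1 + 1)) {0..1}"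
    using assms by (intro has_integral_diff has_integral_powr_unit) auto
  also have "1 / (1 + 1) - 1 / (\<alpha> + 1 + 1) = \<alpha> / (2 * (\<alpha> + 2))"
    using assms by (simp add: field_simps)
  finally show ?thesis
    by (rule has_integral_eq[rotated]) (auto simp: powr_add algebra_simps)
qed

lemma has_integral_weight_powr:
  fixes \<alpha> s :: real
  assumes "\<alpha> > 0" "s > 0"
  shows "((\<lambda>u. u * (1 - u powr \<alpha>) * u powr s) has_integral \<alpha> / ((s + 2) * (\<alpha> + s + 2))) {0..1}"
proof -
  have "((\<lambda>u. u powr (s + 1) - u powr (\<alpha> + s + 1)) has_integral 1 / (s + 1 + 1) - 1 / (\<alpha> + s + 1 + 1)) {0..1}"
    using assms by (intro has_integral_diff has_integral_powr_unit) auto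
  also have "1 / (s + 1 + 1) - 1 / (\<alpha> + s + 1 + 1) = \<alpha> / ((s + 2) * (\<alpha> + s + 2))"
    using assms by (simp add: divide_simps) (simp add: algebra_simps)
  finally show ?thesis
    by (rule has_integral_eq[rotated]) (auto simp: powr_add algebra_simps)
qed

text \<open>Multiplied out, the integrand is the difference of two Beta integrands, with exponents \<open>1, s\<close> and
\<open>\<alpha> + 1, s\<close>.\<close>

lemma has_integral_weight_powr_reflected:
  fixes \<alpha> s :: real
  assumes "\<alpha> > 0" "s > 0"
  shows "((\<lambda>u. u * (1 - u powr \<alpha>) * (1 - u) powr s)
           has_integral Beta 2 (s + 1) - Beta (\<alpha> + 2) (s + 1)) {0..1}"
proof -
  have "((\<lambda>u. u powr (2 - 1) * (1 - u) powr (s + 1 - 1) - u powr (\<alpha> + 2 - 1) * (1 - u) powr (s + 1 - 1))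
           has_integral Beta 2 (s + 1) - Beta (\<alpha> + 2) (s + 1)) {0..1}"
    using assms by (intro has_integral_diff has_integral_Beta_real) auto
  then show ?thesis
    by (rule has_integral_eq[rotated]) (auto simp: powr_add algebra_simps)
qed

lemma absolutely_integrable_continuous_mult:
  fixes f g :: "real \<Rightarrow> real"
  assumes "continuous_on {a..b} f" "g absolutely_integrable_on {a..b}"
  shows "(\<lambda>x. f x * g x) absolutely_integrable_on {a..b}"
proof (rule absolutely_integrable_bounded_measurable_product_real)
  show "f \<in> borel_measurable (lebesgue_on {a..b})"
    using assms(1) by (intro continuous_imp_measurable_on_sets_lebesgue) auto
  show "bounded (f ` {a..b})"
    using assms(1) by (intro compact_imp_bounded compact_continuous_image) auto
qed (use assms in auto)

lemma continuous_on_weight: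
  fixes \<alpha> :: real
  assumes "\<alpha> > 0"
  shows "continuous_on {0..1} (\<lambda>u. u * (1 - u powr \<alpha>))"
  using assms by (intro continuous_intros continuous_on_powr') auto

text \<open>This is one of the two halves of the final estimate. In the power mean inequality
\<open>W * (V / W) powr (1 / q)\<close>, the total mass is \<open>W = \<alpha> / (2 * (\<alpha> + 2))\<close>, and the factors
\<open>2 * \<alpha> + 4\<close> and \<open>(2 * \<alpha> + 4) / \<alpha>\<close> inside the root come from dividing the two moments by \<open>W\<close>.\<close>

lemma weighted_integral_bound:
  fixes g :: "real \<Rightarrow> real"
  assumes "\<alpha> > 0" "s > 0" "q \<ge> 1"
    and g: "g absolutely_integrable_on {0..1}"
    and gq: "\<And>u. u \<in> {0..1} \<Longrightarrow> \<bar>g u\<bar> powr q \<le> u powr s * A + (1 - u) powr s * B"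
  shows "\<bar>integral {0..1} (\<lambda>u. u * (1 - u powr \<alpha>) * g u)\<bar>
    \<le> \<alpha> / (2 * (\<alpha> + 2)) *
      (A * ((2 * \<alpha> + 4) / ((s + 2) * (\<alpha> + s + 2)))
        + B * (Beta 2 (s + 1) - Beta (\<alpha> + 2) (s + 1)) * ((2 * \<alpha> + 4) / \<alpha>)) powr (1 / q)"
proof -
  define W where "W = \<alpha> / (2 * (\<alpha> + 2))"
  define X where "X = \<alpha> / ((s + 2) * (\<alpha> + s + 2))"
  define Y where "Y = Beta 2 (s + 1) - Beta (\<alpha> + 2) (s + 1)"
  have "W > 0" unfolding W_def using assms by simp
  have V: "((\<lambda>u. u * (1 - u powr \<alpha>) * (u powr s * A + (1 - u) powr s * B)) has_integral X * A + Y * B) {0..1}"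
    using has_integral_add[OF has_integral_mult_left[OF has_integral_weight_powr]
        has_integral_mult_left[OF has_integral_weight_powr_reflected], OF assms(1,2) assms(1,2), of A B]
    unfolding X_def Y_def by (rule has_integral_eq[rotated]) (simp add: algebra_simps)
  have "\<bar>integral {0..1} (\<lambda>u. u * (1 - u powr \<alpha>) * g u)\<bar> \<le> W * ((X * A + Y * B) / W) powr (1 / q)"
  proof (rule weighted_power_mean[OF _ _ V])
    show "((\<lambda>u. u * (1 - u powr \<alpha>)) has_integral W) {0..1}"
      unfolding W_def using assms(1) by (rule has_integral_weight)
    show "(\<lambda>u. u * (1 - u powr \<alpha>) * g u) integrable_on {0..1}"
      using absolutely_integrable_continuous_mult[OF continuous_on_weight[OF assms(1)] g]
      by (rule set_lebesgue_integral_eq_integral(1))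
    show "0 \<le> u * (1 - u powr \<alpha>)" if "u \<in> {0..1}" for u
      using that assms powr_le1[of \<alpha> u] by auto
  qed (use assms \<open>W > 0\<close> in auto)
  also have "(X * A + Y * B) / W
      = A * ((2 * \<alpha> + 4) / ((s + 2) * (\<alpha> + s + 2))) + B * Y * ((2 * \<alpha> + 4) / \<alpha>)"
    using assms unfolding X_def W_def
    by (simp add: divide_simps) (simp add: algebra_simps)
  finally show ?thesis unfolding W_def Y_def .
qed

section \<open>The trapezoid error as an integral of the second derivative\<close>

lemma absolutely_integrable_powr_diff_left_end:
  fixes a b \<alpha> :: real
  assumes "a < b" "\<alpha> > 0"
  shows "(\<lambda>t. (t - a) powr (\<alpha> - 1)) absolutely_integrable_on {a..b}"
  using has_integral_powr_shifted[of a b "\<alpha> - 1"] assms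
  by (intro nonnegative_absolutely_integrable_1) auto

lemma absolutely_integrable_powr_diff_right_end:
  fixes a b \<alpha> :: real
  assumes "a < b" "\<alpha> > 0"
  shows "(\<lambda>t. (b - t) powr (\<alpha> - 1)) absolutely_integrable_on {a..b}"
  using absolutely_integrable_powr_diff_left_end[of "-b" "-a" \<alpha>] assms
    absolutely_integrable_reflect_real[where f = "\<lambda>t. (b - t) powr (\<alpha> - 1)" and a = a and b = b]
  by (simp add: add.commute)

text \<open>Apart from a constant factor, the second derivative of \<open>P\<close> is the sum of the two Riemann-Liouville
kernels. Hence two integrations by parts, done at once by integrating
\<open>(P * f' - P' * f)' = P * f'' - P'' * f\<close>, relate the fractional integrals of \<open>f\<close> to the integral of
\<open>P * f''\<close>. As \<open>P\<close> vanishes at both ends while \<open>P'\<close> takes opposite values there, the boundary terms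
combine to a multiple of \<open>f a + f b\<close>. For \<open>\<alpha> < 1\<close> the function \<open>P''\<close> is unbounded at both ends, so the
fundamental theorem is used in the form that asks for a derivative in the open interval only.\<close>

lemma fractional_trapezoid_identity:
  fixes f f' f'' :: "real \<Rightarrow> real" and a b \<alpha> :: real
  assumes ab: "a < b" and \<alpha>: "\<alpha> > 0"
    and f: "\<And>x. x \<in> {a..b} \<Longrightarrow> (f has_real_derivative f' x) (at x)"
    and f': "\<And>x. x \<in> {a..b} \<Longrightarrow> (f' has_real_derivative f'' x) (at x)"
    and f'': "f'' absolutely_integrable_on {a..b}"
  defines "P \<equiv> \<lambda>t. (b - a) powr (\<alpha> + 1) - (b - t) powr (\<alpha> + 1) - (t - a) powr (\<alpha> + 1)"
  shows "(f a + f b) / 2 - Gamma (\<alpha> + 1) / (2 * (b - a) powr \<alpha>) *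
            (RL_integral_left \<alpha> a f b + RL_integral_right \<alpha> b f a)
    = integral {a..b} (\<lambda>t. P t * f'' t) / (2 * (\<alpha> + 1) * (b - a) powr \<alpha>)"
proof -
  define P' where "P' t = (\<alpha> + 1) * ((b - t) powr \<alpha> - (t - a) powr \<alpha>)" for t
  have contf: "continuous_on {a..b} f" and contf': "continuous_on {a..b} f'"
    using f f' DERIV_isCont by (meson continuous_at_imp_continuous_on)+
  have contP: "continuous_on {a..b} P" and contP': "continuous_on {a..b} P'"
    unfolding P_def P'_def using \<alpha> by (auto intro!: continuous_intros continuous_on_powr')
  have dP: "(P has_real_derivative P' t) (at t)"
    and dP': "(P' has_real_derivative
      - ((\<alpha> + 1) * \<alpha> * ((b - t) powr (\<alpha> - 1) + (t - a) powr (\<alpha> - 1)))) (at t)"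
    if "t \<in> {a<..<b}" for t
    unfolding P_def P'_def using that \<alpha>
    by (auto intro!: derivative_eq_intros simp: algebra_simps)
  define L where "L = integral {a..b} (\<lambda>t. (b - t) powr (\<alpha> - 1) * f t)"
  define R where "R = integral {a..b} (\<lambda>t. (t - a) powr (\<alpha> - 1) * f t)"
  have absL: "(\<lambda>t. (b - t) powr (\<alpha> - 1) * f t) absolutely_integrable_on {a..b}"
    using absolutely_integrable_continuous_mult[OF contf absolutely_integrable_powr_diff_right_end[OF ab \<alpha>]]
    by (simp add: mult.commute)
  have absR: "(\<lambda>t. (t - a) powr (\<alpha> - 1) * f t) absolutely_integrable_on {a..b}"
    using absolutely_integrable_continuous_mult[OF contf absolutely_integrable_powr_diff_left_end[OF ab \<alpha>]]
    by (simp add: mult.commute)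
  have LR: "RL_integral_left \<alpha> a f b = L / Gamma \<alpha>" "RL_integral_right \<alpha> b f a = R / Gamma \<alpha>"
    unfolding RL_integral_left_def RL_integral_right_def L_def R_def
    using set_lebesgue_integral_eq_integral(2)[OF absL] set_lebesgue_integral_eq_integral(2)[OF absR]
    by simp_all
  have Pf'': "(\<lambda>t. P t * f'' t) integrable_on {a..b}"
    using absolutely_integrable_continuous_mult[OF contP f'']
    by (rule set_lebesgue_integral_eq_integral(1))
  have split: "((\<lambda>t. P t * f'' t + (\<alpha> + 1) * \<alpha> * ((b - t) powr (\<alpha> - 1) * f t + (t - a) powr (\<alpha> - 1) * f t))
      has_integral integral {a..b} (\<lambda>t. P t * f'' t) + (\<alpha> + 1) * \<alpha> * (L + R)) {a..b}"
    unfolding L_def R_def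
    by (intro has_integral_add has_integral_mult_right integrable_integral Pf''
        set_lebesgue_integral_eq_integral(1)[OF absL] set_lebesgue_integral_eq_integral(1)[OF absR])
  have ftc: "((\<lambda>t. P t * f'' t + (\<alpha> + 1) * \<alpha> * ((b - t) powr (\<alpha> - 1) * f t + (t - a) powr (\<alpha> - 1) * f t))
      has_integral (P b * f' b - P' b * f b) - (P a * f' a - P' a * f a)) {a..b}"
  proof (rule fundamental_theorem_of_calculus_interior)
    show "continuous_on {a..b} (\<lambda>t. P t * f' t - P' t * f t)"
      by (intro continuous_intros contP contP' contf contf')
    fix t assume t: "t \<in> {a<..<b}"
    then have t': "t \<in> {a..b}" by auto
    show "((\<lambda>t. P t * f' t - P' t * f t) has_vector_derivative
        P t * f'' t + (\<alpha> + 1) * \<alpha> * ((b - t) powr (\<alpha> - 1) * f t + (t - a) powr (\<alpha> - 1) * f t)) (at t)"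
      unfolding has_real_derivative_iff_has_vector_derivative[symmetric]
      by (rule derivative_eq_intros dP[OF t] dP'[OF t] f[OF t'] f'[OF t'] refl)+
         (simp add: algebra_simps)
  qed (use ab in auto)
  \<comment> \<open>\<open>P a = P b = 0\<close>, and \<open>P' a = (\<alpha> + 1) * (b - a) powr \<alpha> = - P' b\<close>.\<close>
  have boundary: "(P b * f' b - P' b * f b) - (P a * f' a - P' a * f a)
      = (\<alpha> + 1) * (b - a) powr \<alpha> * (f a + f b)"
    unfolding P_def P'_def using ab \<alpha> by (simp add: algebra_simps)
  have key: "integral {a..b} (\<lambda>t. P t * f'' t) + (\<alpha> + 1) * \<alpha> * (L + R)
      = (\<alpha> + 1) * (b - a) powr \<alpha> * (f a + f b)"
    using has_integral_unique[OF split ftc] boundary by simp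
  have "\<alpha> \<notin> \<int>\<^sub>\<le>\<^sub>0" using \<alpha> by (auto dest: nonpos_Ints_nonpos)
  then have \<Gamma>: "Gamma (\<alpha> + 1) = \<alpha> * Gamma \<alpha>" by (rule Gamma_plus1)
  have G0: "Gamma \<alpha> > 0" using \<alpha> by (rule Gamma_real_pos)
  have h0: "(b - a) powr \<alpha> > 0" using ab by simp
  have "Gamma (\<alpha> + 1) * (L / Gamma \<alpha> + R / Gamma \<alpha>) = \<alpha> * (L + R)"
    unfolding \<Gamma> using G0 by (simp add: field_simps)
  then have "(f a + f b) / 2 - Gamma (\<alpha> + 1) / (2 * (b - a) powr \<alpha>) * (L / Gamma \<alpha> + R / Gamma \<alpha>)
     = (f a + f b) / 2 - \<alpha> * (L + R) / (2 * (b - a) powr \<alpha>)" by simp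
  also have "\<dots> = ((\<alpha> + 1) * (b - a) powr \<alpha> * (f a + f b) - (\<alpha> + 1) * \<alpha> * (L + R))
      / (2 * (\<alpha> + 1) * (b - a) powr \<alpha>)"
    using h0 \<alpha> by (simp add: divide_simps) (simp add: algebra_simps)
  finally show ?thesis unfolding LR key[symmetric] by simp
qed

section \<open>Passage to the unit interval\<close>

lemma has_integral_unit_interval_substitution:
  fixes F :: "real \<Rightarrow> real"
  assumes "(F has_integral i) {a..b}" "a < b"
  shows "((\<lambda>u. F (a + (b - a) * u)) has_integral i / (b - a)) {0..1}"
proof -
  have "((\<lambda>u. F ((b - a) *\<^sub>R u + a)) has_integral (i /\<^sub>R (b - a) ^ DIM(real)))
           (cbox ((a - a) /\<^sub>R (b - a)) ((b - a) /\<^sub>R (b - a)))"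
    using assms by (intro has_integral_affinity') auto
  then show ?thesis using assms by (simp add: field_simps)
qed

lemma has_integral_unit_interval_reflect:
  fixes F :: "real \<Rightarrow> real"
  assumes "(F has_integral i) {0..1}"
  shows "((\<lambda>u. F (1 - u)) has_integral i) {0..1}"
  using has_integral_affinity[of F i 0 1 "-1" 1] assms by simp

lemma absolutely_integrable_unit_interval_substitution:
  fixes G :: "real \<Rightarrow> real"
  assumes G: "G absolutely_integrable_on {a..b}" and ab: "a < b"
  shows "(\<lambda>u. G (a + (b - a) * u)) absolutely_integrable_on {0..1}"
    and "(\<lambda>u. G (b - (b - a) * u)) absolutely_integrable_on {0..1}"
proof -
  have subst: "(\<lambda>u. F (a + (b - a) * u)) integrable_on {0..1}"
    and reflect: "(\<lambda>u. F (b - (b - a) * u)) integrable_on {0..1}"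
    if "F integrable_on {a..b}" for F :: "real \<Rightarrow> real"
  proof -
    note F = has_integral_unit_interval_substitution[OF integrable_integral[OF that] ab]
    show "(\<lambda>u. F (a + (b - a) * u)) integrable_on {0..1}" using F by blast
    have "a + (b - a) * (1 - u) = b - (b - a) * u" for u by (simp add: algebra_simps)
    with has_integral_unit_interval_reflect[OF F]
    show "(\<lambda>u. F (b - (b - a) * u)) integrable_on {0..1}" by auto
  qed
  have "G integrable_on {a..b}" "(\<lambda>t. norm (G t)) integrable_on {a..b}"
    using G by (auto simp: absolutely_integrable_on_def)
  then show "(\<lambda>u. G (a + (b - a) * u)) absolutely_integrable_on {0..1}"
    and "(\<lambda>u. G (b - (b - a) * u)) absolutely_integrable_on {0..1}"
    using subst reflect by (auto simp: absolutely_integrable_on_def)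
qed

text \<open>At \<open>t = a + (b - a) * u\<close> the kernel equals \<open>(b - a) powr (\<alpha> + 1)\<close> times
\<open>1 - u powr (\<alpha> + 1) - (1 - u) powr (\<alpha> + 1) = w u + w (1 - u)\<close>, where \<open>w u = u * (1 - u powr \<alpha>)\<close>: here
\<open>1\<close> is read as \<open>u + (1 - u)\<close>. The reflection \<open>u \<mapsto> 1 - u\<close> brings the second summand back to the
weight \<open>w\<close>. This splitting, rather than the symmetric kernel, is what leads to a separate root for
each end point.\<close>

lemma integral_trapezoid_kernel_split:
  fixes G :: "real \<Rightarrow> real" and a b \<alpha> :: real
  assumes ab: "a < b" and \<alpha>: "\<alpha> > 0" and G: "G absolutely_integrable_on {a..b}"
  shows "integral {a..b} (\<lambda>t. ((b - a) powr (\<alpha> + 1) - (b - t) powr (\<alpha> + 1) - (t - a) powr (\<alpha> + 1)) * G t)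
    = (b - a) powr \<alpha> * (b - a)\<^sup>2 *
      (integral {0..1} (\<lambda>u. u * (1 - u powr \<alpha>) * G (a + (b - a) * u))
       + integral {0..1} (\<lambda>u. u * (1 - u powr \<alpha>) * G (b - (b - a) * u)))"
    (is "integral _ (\<lambda>t. ?P t * G t) = _ * (?I1 + ?I2)")
proof -
  let ?w = "\<lambda>u::real. u * (1 - u powr \<alpha>)"
  have "continuous_on {a..b} ?P"
    using \<alpha> by (auto intro!: continuous_intros continuous_on_powr')
  from absolutely_integrable_continuous_mult[OF this G]
  have "((\<lambda>t. ?P t * G t) has_integral integral {a..b} (\<lambda>t. ?P t * G t)) {a..b}"
    by (intro integrable_integral set_lebesgue_integral_eq_integral(1))
  from has_integral_unit_interval_substitution[OF this ab]
  have lhs: "((\<lambda>u. ?P (a + (b - a) * u) * G (a + (b - a) * u))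
      has_integral integral {a..b} (\<lambda>t. ?P t * G t) / (b - a)) {0..1}" .
  have w_int: "((\<lambda>u. ?w u * H u) has_integral integral {0..1} (\<lambda>u. ?w u * H u)) {0..1}"
    if "H absolutely_integrable_on {0..1}" for H
    using absolutely_integrable_continuous_mult[OF continuous_on_weight[OF \<alpha>] that]
    by (intro integrable_integral set_lebesgue_integral_eq_integral(1))
  note G1 = w_int[OF absolutely_integrable_unit_interval_substitution(1)[OF G ab]]
  note G2 = has_integral_unit_interval_reflect
    [OF w_int[OF absolutely_integrable_unit_interval_substitution(2)[OF G ab]]]
  have rhs: "((\<lambda>u. ?P (a + (b - a) * u) * G (a + (b - a) * u))
      has_integral (b - a) powr (\<alpha> + 1) * (?I1 + ?I2)) {0..1}"
  proof (rule has_integral_eq[OF _ has_integral_mult_right[OF has_integral_add[OF G1 G2]]])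
    fix u :: real assume u: "u \<in> {0..1}"
    have t: "b - (b - a) * (1 - u) = a + (b - a) * u" "b - (a + (b - a) * u) = (b - a) * (1 - u)"
      "a + (b - a) * u - a = (b - a) * u"
      by (simp_all add: algebra_simps)
    have "?P (a + (b - a) * u)
        = (b - a) powr (\<alpha> + 1) * (1 - (1 - u) powr (\<alpha> + 1) - u powr (\<alpha> + 1))"
      unfolding t using u ab by (simp add: powr_mult) (simp only: right_diff_distrib mult_1_right)
    also have "1 - (1 - u) powr (\<alpha> + 1) - u powr (\<alpha> + 1) = ?w u + ?w (1 - u)"
      using u by (simp add: powr_add) (simp add: algebra_simps)
    finally have "?P (a + (b - a) * u) = (b - a) powr (\<alpha> + 1) * (?w u + ?w (1 - u))" .
    then show "(b - a) powr (\<alpha> + 1) * (?w u * G (a + (b - a) * u) + ?w (1 - u) * G (b - (b - a) * (1 - u)))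
        = ?P (a + (b - a) * u) * G (a + (b - a) * u)"
      unfolding t by (simp only: distrib_right mult.assoc)
  qed
  have "integral {a..b} (\<lambda>t. ?P t * G t) / (b - a) = (b - a) powr (\<alpha> + 1) * (?I1 + ?I2)"
    using lhs rhs by (rule has_integral_unique)
  then have "integral {a..b} (\<lambda>t. ?P t * G t) = (b - a) * (b - a) powr (\<alpha> + 1) * (?I1 + ?I2)"
    using ab by (simp add: field_simps)
  then show ?thesis
    using ab by (simp add: powr_add power2_eq_square mult.commute mult.left_commute)
qed

section \<open>The fractional trapezoid inequality\<close>

theorem theorem8:
  fixes I :: "real set" and f f' f'' :: "real \<Rightarrow> real" and a b q s \<alpha> :: real
  assumes "is_interval I"
    and "\<And>x. x \<in> interior I \<Longrightarrow> (f has_real_derivative f' x) (at x)"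
    and "\<And>x. x \<in> interior I \<Longrightarrow> (f' has_real_derivative f'' x) (at x)"
    and "a \<in> interior I" and "b \<in> interior I" and "a < b"
    and "set_integrable lebesgue {a..b} f''"
    and "q \<ge> 1" and "0 < s" and "s \<le> 1"
    and "s_convex_on s (interior I) (\<lambda>x. \<bar>f'' x\<bar> powr q)"
    and "\<alpha> > 0"
  shows "\<bar>(f a + f b) / 2 - Gamma (\<alpha> + 1) / (2 * (b - a) powr \<alpha>) *
            (RL_integral_left \<alpha> a f b + RL_integral_right \<alpha> b f a)\<bar>
    \<le> \<alpha> * (b - a)\<^sup>2 / (4 * (\<alpha> + 1) * (\<alpha> + 2)) *
       ((\<bar>f'' a\<bar> powr q * ((2 * \<alpha> + 4) / ((s + 2) * (\<alpha> + s + 2)))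
          + \<bar>f'' b\<bar> powr q * (Beta 2 (s + 1) - Beta (\<alpha> + 2) (s + 1)) * ((2 * \<alpha> + 4) / \<alpha>))
            powr (1 / q)
        + (\<bar>f'' a\<bar> powr q * (Beta 2 (s + 1) - Beta (\<alpha> + 2) (s + 1)) * ((2 * \<alpha> + 4) / \<alpha>)
          + \<bar>f'' b\<bar> powr q * ((2 * \<alpha> + 4) / ((s + 2) * (\<alpha> + s + 2))))
            powr (1 / q))"
proof -
  note is_int = assms(1) and df = assms(2) and df' = assms(3) and aI = assms(4) and bI = assms(5)
    and ab = assms(6) and f'' = assms(7) and q = assms(8) and s = assms(9)
    and sconv = assms(11) and \<alpha> = assms(12)
  have "convex (interior I)"
    using is_int by (simp add: is_interval_convex_1 convex_interior)
  then have sub: "{a..b} \<subseteq> interior I"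
    using closed_segment_subset[OF aI bI] ab by (simp add: closed_segment_eq_real_ivl1)
  define I1 where "I1 = integral {0..1} (\<lambda>u. u * (1 - u powr \<alpha>) * f'' (a + (b - a) * u))"
  define I2 where "I2 = integral {0..1} (\<lambda>u. u * (1 - u powr \<alpha>) * f'' (b - (b - a) * u))"
  let ?A = "\<bar>f'' a\<bar> powr q" and ?B = "\<bar>f'' b\<bar> powr q"
  let ?X = "(2 * \<alpha> + 4) / ((s + 2) * (\<alpha> + s + 2))"
    and ?Y = "Beta 2 (s + 1) - Beta (\<alpha> + 2) (s + 1)" and ?Z = "(2 * \<alpha> + 4) / \<alpha>"
  have "(f a + f b) / 2 - Gamma (\<alpha> + 1) / (2 * (b - a) powr \<alpha>) *
            (RL_integral_left \<alpha> a f b + RL_integral_right \<alpha> b f a)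
      = (b - a) powr \<alpha> * (b - a)\<^sup>2 * (I1 + I2) / (2 * (\<alpha> + 1) * (b - a) powr \<alpha>)"
    using fractional_trapezoid_identity[OF ab \<alpha> df df' f''] sub
    unfolding integral_trapezoid_kernel_split[OF ab \<alpha> f''] I1_def I2_def by blast
  also have "\<dots> = (b - a)\<^sup>2 / (2 * (\<alpha> + 1)) * (I1 + I2)"
    using ab by simp
  finally have "\<bar>(f a + f b) / 2 - Gamma (\<alpha> + 1) / (2 * (b - a) powr \<alpha>) *
            (RL_integral_left \<alpha> a f b + RL_integral_right \<alpha> b f a)\<bar>
      = (b - a)\<^sup>2 / (2 * (\<alpha> + 1)) * \<bar>I1 + I2\<bar>"
    using \<alpha> by (simp add: abs_mult)
  also have "\<dots> \<le> (b - a)\<^sup>2 / (2 * (\<alpha> + 1)) *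
      (\<alpha> / (2 * (\<alpha> + 2)) * (?B * ?X + ?A * ?Y * ?Z) powr (1 / q)
        + \<alpha> / (2 * (\<alpha> + 2)) * (?A * ?X + ?B * ?Y * ?Z) powr (1 / q))"
  proof (rule mult_left_mono)
    have "\<bar>I1\<bar> \<le> \<alpha> / (2 * (\<alpha> + 2)) * (?B * ?X + ?A * ?Y * ?Z) powr (1 / q)"
      unfolding I1_def
    proof (rule weighted_integral_bound[OF \<alpha> s q
          absolutely_integrable_unit_interval_substitution(1)[OF f'' ab]])
      fix u :: real assume "u \<in> {0..1}"
      then have "\<bar>f'' (u * b + (1 - u) * a)\<bar> powr q \<le> u powr s * ?B + (1 - u) powr s * ?A"
        using sconv aI bI unfolding s_convex_on_def by blast
      also have "u * b + (1 - u) * a = a + (b - a) * u" by (simp add: algebra_simps)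
      finally show "\<bar>f'' (a + (b - a) * u)\<bar> powr q \<le> u powr s * ?B + (1 - u) powr s * ?A" .
    qed
    moreover have "\<bar>I2\<bar> \<le> \<alpha> / (2 * (\<alpha> + 2)) * (?A * ?X + ?B * ?Y * ?Z) powr (1 / q)"
      unfolding I2_def
    proof (rule weighted_integral_bound[OF \<alpha> s q
          absolutely_integrable_unit_interval_substitution(2)[OF f'' ab]])
      fix u :: real assume "u \<in> {0..1}"
      then have "\<bar>f'' (u * a + (1 - u) * b)\<bar> powr q \<le> u powr s * ?A + (1 - u) powr s * ?B"
        using sconv aI bI unfolding s_convex_on_def by blast
      also have "u * a + (1 - u) * b = b - (b - a) * u" by (simp add: algebra_simps)
      finally show "\<bar>f'' (b - (b - a) * u)\<bar> powr q \<le> u powr s * ?A + (1 - u) powr s * ?B" .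
    qed
    ultimately show "\<bar>I1 + I2\<bar> \<le> \<alpha> / (2 * (\<alpha> + 2)) * (?B * ?X + ?A * ?Y * ?Z) powr (1 / q)
        + \<alpha> / (2 * (\<alpha> + 2)) * (?A * ?X + ?B * ?Y * ?Z) powr (1 / q)"
      by linarith
  qed (use \<alpha> in simp)
  also have "\<dots> = \<alpha> * (b - a)\<^sup>2 / (4 * (\<alpha> + 1) * (\<alpha> + 2)) *
      ((?A * ?X + ?B * ?Y * ?Z) powr (1 / q) + (?A * ?Y * ?Z + ?B * ?X) powr (1 / q))"
  proof -
    have "h / (2 * (\<alpha> + 1)) * (\<alpha> / (2 * (\<alpha> + 2)) * x + \<alpha> / (2 * (\<alpha> + 2)) * y)
        = \<alpha> * h / (4 * (\<alpha> + 1) * (\<alpha> + 2)) * (y + x)" for h x y :: real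
      using \<alpha> by (simp add: divide_simps) (simp add: algebra_simps)
    then show ?thesis by (simp only: add.commute[of "?B * ?X"])
  qed
  finally show ?thesis .
qed

end
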